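(* Let $d\in\mathbb{N}$, $\beta\ge1$, $\ell$ the largest integer strictly smaller than $\beta$, $L_0,\dots,L_\ell,L_\beta>0$, and $p\in[1,\infty)$. Then there is a constant $C>0$ large enough, depending only on $d,\beta,L_0,\dots,L_\ell,L_\beta,p$, with the following property. Let $x_0\in[0,1]^d$ and $\Delta t>0$ with $\Delta t\le C^{-1}$. Then there are $f_0,f_1\in\mathcal{F}_{d,\beta}$ such that $$U(f_0,x,i\Delta t)=U(f_1,x,i\Delta t)\qquad\text{for all } i\in\mathbb{Z},\ x\in\mathbb{R}^d,$$ and $$C\,\|f_0(x_0)-f_1(x_0)\|_2\ge \Delta t^{\beta}\qquad\text{and}\qquad C\,\big\|\,\|f_0-f_1\|_2\,\big\|_{L^p([0,1]^d)}\ge\Delta t^{\beta}.$$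
   Context: $\mathcal{F}_{d,\beta}$ is the set of functions $f=(f_1,\dots,f_d):\mathbb{R}^d\to\mathbb{R}^d$ such that each component $f_j$ is $\ell$ times differentiable, $\sup_x\|D^kf_j(x)\|_{\mathsf{op}}\le L_k$ for $k=0,\dots,\ell$, and $\|D^\ell f_j(x)-D^\ell f_j(\tilde x)\|_{\mathsf{op}}\le L_\beta\|x-\tilde x\|_2^{\beta-\ell}$ for all $x,\tilde x\in\mathbb{R}^d$. Here $D^k f_j(x)$ is the $k$-th derivative as a symmetric $k$-linear form and $\|A\|_{\mathsf{op}}=\sup\{|A(v_1,\dots,v_k)|:\|v_i\|_2=1\}$; $\|\cdot\|_2$ is the Euclidean norm. For a globally Lipschitz $f:\mathbb{R}^d\to\mathbb{R}^d$ and $x\in\mathbb{R}^d$, $t\mapsto U(f,x,t)$, $t\in\mathbb{R}$, is the solution of $\dot u(t)=f(u(t))$, $u(0)=x$. *)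

theory Defs
  imports "HOL-Analysis.Analysis"
begin

text \<open>
  The iterated Frechet derivative, as a multilinear form evaluated at a list of directions:
  \<open>iter_deriv f x [v1, ..., vk]\<close> is \<open>D^k f(x)(v1, ..., vk)\<close>. As usual,
  \<open>D^(k+1) f(x)(v, v1, ..., vk)\<close> is the derivative at \<open>x\<close> in direction \<open>v\<close> of the map
  \<open>y \<mapsto> D^k f(y)(v1, ..., vk)\<close>.
\<close>

primrec iter_deriv_aux :: "'a::real_normed_vector list \<Rightarrow> ('a \<Rightarrow> real) \<Rightarrow> 'a \<Rightarrow> real" where
  "iter_deriv_aux [] f = f"
| "iter_deriv_aux (v # vs) f = (\<lambda>x. frechet_derivative (iter_deriv_aux vs f) (at x) v)"

definition iter_deriv :: "('a::real_normed_vector \<Rightarrow> real) \<Rightarrow> 'a \<Rightarrow> 'a list \<Rightarrow> real" where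
  "iter_deriv f x vs = iter_deriv_aux vs f x"

text \<open>
  \<open>f\<close> is \<open>n\<close> times differentiable if \<open>D^k f\<close> is Frechet differentiable everywhere for all
  \<open>k < n\<close>. On a finite-dimensional space the \<open>k\<close>-linear forms are finite-dimensional too, so
  differentiability of the form-valued map \<open>D^k f\<close> is differentiability of each of its values
  at fixed directions.
\<close>

definition times_differentiable :: "nat \<Rightarrow> ('a::euclidean_space \<Rightarrow> real) \<Rightarrow> bool" where
  "times_differentiable n f \<longleftrightarrow>
     (\<forall>vs x. length vs < n \<longrightarrow> (\<lambda>y. iter_deriv f y vs) differentiable (at x))"

text \<open>Extended-real valued, so that the supremum is meaningful without a boundedness proviso.\<close>

definition form_op_norm :: "nat \<Rightarrow> ('a::real_normed_vector list \<Rightarrow> real) \<Rightarrow> ereal" where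
  "form_op_norm k A =
     (SUP vs \<in> {vs. length vs = k \<and> (\<forall>v \<in> set vs. norm v = 1)}. ereal \<bar>A vs\<bar>)"

text \<open>The largest integer strictly smaller than \<open>\<beta>\<close>; natural numbers suffice as \<open>\<beta> \<ge> 1\<close>.\<close>

definition smoothness_order :: "real \<Rightarrow> nat" where
  "smoothness_order \<beta> = (GREATEST l. real l < \<beta>)"

text \<open>
  The class \<open>F_{d,\<beta>}\<close> with \<open>d = CARD('n)\<close>; only the values \<open>L k\<close> for
  \<open>k \<le> smoothness_order \<beta>\<close> are relevant, and \<open>L\<beta>\<close> is the Hoelder constant.
\<close>

definition smooth_class :: "real \<Rightarrow> (nat \<Rightarrow> real) \<Rightarrow> real \<Rightarrow> (real^'n \<Rightarrow> real^'n) set" where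
  "smooth_class \<beta> L L\<beta> = {f. \<forall>j. let g = (\<lambda>x. f x $ j); l = smoothness_order \<beta> in
     times_differentiable l g \<and>
     (\<forall>k\<le>l. (SUP x. form_op_norm k (iter_deriv g x)) \<le> ereal (L k)) \<and>
     (\<forall>x y. form_op_norm l (\<lambda>vs. iter_deriv g x vs - iter_deriv g y vs)
              \<le> ereal (L\<beta> * norm (x - y) powr (\<beta> - real l)))}"

text \<open>
  The solution of \<open>u' = f(u)\<close>, \<open>u(0) = x\<close> on the whole real line. It exists and is unique for
  globally Lipschitz \<open>f\<close>, in particular for the members of \<open>smooth_class \<beta> L L\<beta>\<close> with
  \<open>\<beta> \<ge> 1\<close>.
\<close>

definition ode_flow :: "('a::real_normed_vector \<Rightarrow> 'a) \<Rightarrow> 'a \<Rightarrow> real \<Rightarrow> 'a" where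
  "ode_flow f x =
     (THE u. u 0 = x \<and> (\<forall>t. (u has_vector_derivative f (u t)) (at t)))"

definition Lp_norm_on :: "real \<Rightarrow> 'a::euclidean_space set \<Rightarrow> ('a \<Rightarrow> real) \<Rightarrow> real" where
  "Lp_norm_on p S g = (LINT x:S|lborel. \<bar>g x\<bar> powr p) powr (1 / p)"

end

theory Submission
  imports Defs
begin

text \<open>
  Let both fields point along one coordinate axis and depend on that coordinate \<open>y\<close> alone, so
  that everything happens for scalar equations \<open>y' = g y\<close>. Take the constant speed \<open>b\<close> for
  one of them. For the other take a positive speed whose period is exactly the distance
  \<open>b \<Delta>t\<close> covered in time \<open>\<Delta>t\<close> at speed \<open>b\<close>, and arrange that crossing one period also
  takes time \<open>\<Delta>t\<close>. Then the two flows shift space by the same vector at time \<open>\<Delta>t\<close>, and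
  hence agree at all multiples of \<open>\<Delta>t\<close>.

  The crossing time of a period is the integral of \<open>1 / g\<close> over it, so \<open>1 / g\<close> must have mean
  \<open>1 / b\<close>. It is convenient to let \<open>1 / g\<close> be the Poisson kernel
  \<open>(1 - q^2) / (b (1 + 2 q cos z + q^2))\<close> with \<open>z = \<omega> (y - y0)\<close> and
  \<open>\<omega> = 2 pi / (b \<Delta>t)\<close>. Its mean is \<open>1 / b\<close> for every \<open>q\<close>, its primitive is
  elementary (\<open>poisson_time\<close>), and its reciprocal is a constant plus a multiple of \<open>cos z\<close>,
  so that all derivatives of the field are known exactly. The constant field is the case
  \<open>q = 0\<close>.

  The oscillating part has amplitude of order \<open>q\<close> and frequency of order \<open>1 / \<Delta>t\<close>, so the
  \<open>k\<close>-th derivative has order \<open>q \<Delta>t^(-k)\<close> and the Hoelder constant of the highest one has order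
  \<open>q \<Delta>t^(-\<beta>)\<close>. The largest admissible choice is therefore \<open>q = c \<Delta>t^\<beta>\<close> with a small
  constant \<open>c\<close> (\<open>axis_wave_in_smooth_class\<close>).
  The difference of the two speeds is a number of size \<open>q\<close> times \<open>q + cos z\<close>, which is
  maximal at \<open>y = y0\<close> and has an \<open>L^p\<close> norm over the cube comparable to \<open>q\<close>
  as soon as the frequency is at least \<open>6\<close> (\<open>Lp_norm_shifted_cos_wave_ge\<close>). Placing \<open>y0\<close> at
  the coordinate of \<open>x0\<close> gives both lower bounds at once.
\<close>

section \<open>Plane cosine waves in the smoothness class\<close>

lemma axis_wave_has_derivative:
  fixes i :: "'n::finite" and a P \<omega> y0 c :: real
  shows "((\<lambda>x::real^'n. a + P * cos (\<omega> * (x $ i - y0) + c)) has_derivative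
      (\<lambda>h. P * (- sin (\<omega> * (x $ i - y0) + c) * (\<omega> * h $ i)))) (at x)"
  by (auto intro!: derivative_eq_intros bounded_linear.has_derivative[OF bounded_linear_vec_nth]
      simp: fun_eq_iff)

text \<open>
  Each differentiation multiplies by \<open>\<omega> v_i\<close> and advances the phase by a quarter period, so one
  formula covers every order; only the constant term distinguishes order zero.
\<close>
lemma iter_deriv_wave:
  fixes i :: "'n::finite" and A B \<omega> y0 :: real
  shows "iter_deriv_aux vs (\<lambda>x::real^'n. A + B * cos (\<omega> * (x $ i - y0))) =
    (\<lambda>x. (if vs = [] then A else 0) + B * \<omega> ^ length vs * prod_list (map (\<lambda>v. v $ i) vs)
            * cos (\<omega> * (x $ i - y0) + real (length vs) * (pi / 2)))"
proof (induction vs)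
  case Nil
  then show ?case by simp
next
  case (Cons v vs)
  define P where "P = B * \<omega> ^ length vs * prod_list (map (\<lambda>v. v $ i) vs)"
  define a where "a = (if vs = [] then A else 0)"
  define c where "c = real (length vs) * (pi / 2)"
  have shift: "cos (z + real (length (v # vs)) * (pi / 2)) = - sin (z + c)" for z
  proof -
    have "z + real (length (v # vs)) * (pi / 2) = (z + c) + pi / 2"
      by (simp add: c_def field_simps)
    then show ?thesis
      by (simp only: cos_add[of "z + c" "pi / 2"] cos_pi_half sin_pi_half mult_zero_right
          mult_1_right diff_0)
  qed
  show ?case
    unfolding shift iter_deriv_aux.simps Cons.IH
    unfolding P_def[symmetric] a_def[symmetric] c_def[symmetric]
      frechet_derivative_at[OF axis_wave_has_derivative, symmetric]
    by (simp add: P_def fun_eq_iff)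
qed

lemma smoothness_order_bounds:
  assumes "\<beta> \<ge> 1"
  shows "real (smoothness_order \<beta>) < \<beta>" and "\<beta> \<le> real (smoothness_order \<beta>) + 1"
proof -
  have zero: "real 0 < \<beta>" using assms by simp
  have bound: "\<forall>n. real n < \<beta> \<longrightarrow> n \<le> nat \<lceil>\<beta>\<rceil>" by (auto simp: le_nat_iff) linarith
  show "real (smoothness_order \<beta>) < \<beta>"
    unfolding smoothness_order_def using GreatestI_nat[of "\<lambda>l. real l < \<beta>", OF zero] bound by blast
  show "\<beta> \<le> real (smoothness_order \<beta>) + 1"
  proof (rule ccontr)
    assume "\<not> ?thesis"
    then have "real (Suc (smoothness_order \<beta>)) < \<beta>" by simp
    then have "Suc (smoothness_order \<beta>) \<le> smoothness_order \<beta>"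
      unfolding smoothness_order_def using Greatest_le_nat[of "\<lambda>l. real l < \<beta>"] bound by blast
    then show False by simp
  qed
qed

lemma abs_prod_list_components_le_1:
  fixes i :: "'n::finite"
  assumes "\<And>v::real^'n. v \<in> set vs \<Longrightarrow> norm v = 1"
  shows "\<bar>prod_list (map (\<lambda>v. v $ i) vs)\<bar> \<le> 1"
  using assms
proof (induction vs)
  case (Cons v vs)
  then have "\<bar>v $ i\<bar> \<le> 1" using component_le_norm_cart[of v i] by simp
  with Cons show ?case by (simp add: abs_mult mult_le_one)
qed simp

text \<open>
  The difference is bounded both by \<open>2\<close> and by the distance of the arguments; whichever is the
  smaller is dominated by every intermediate power of the distance.
\<close>
lemma cos_Hoelder:
  fixes x y \<gamma> :: real
  assumes "0 \<le> \<gamma>" "\<gamma> \<le> 1"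
  shows "\<bar>cos x - cos y\<bar> \<le> 2 * \<bar>x - y\<bar> powr \<gamma>"
proof (cases "\<bar>x - y\<bar> \<le> 1")
  case True
  have "\<bar>cos x - cos y\<bar> \<le> \<bar>x - y\<bar>"
  proof -
    have "cos x - cos y = 2 * sin ((x + y) / 2) * sin ((y - x) / 2)" by (rule cos_diff_cos)
    then have "\<bar>cos x - cos y\<bar> = 2 * \<bar>sin ((x + y) / 2)\<bar> * \<bar>sin ((y - x) / 2)\<bar>"
      by (simp add: abs_mult)
    also have "\<dots> \<le> 2 * 1 * \<bar>(y - x) / 2\<bar>"
      by (intro mult_mono abs_sin_x_le_abs_x) auto
    finally show ?thesis by simp
  qed
  also have "\<dots> \<le> \<bar>x - y\<bar> powr \<gamma>"
    using True assms powr_mono'[of \<gamma> 1 "\<bar>x - y\<bar>"] by (cases "x = y") auto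
  finally show ?thesis using powr_ge_zero[of "\<bar>x - y\<bar>" \<gamma>] by linarith
next
  case False
  have "\<bar>cos x - cos y\<bar> \<le> 2" using abs_cos_le_one[of x] abs_cos_le_one[of y] by linarith
  also have "\<dots> \<le> 2 * \<bar>x - y\<bar> powr \<gamma>" using False assms by (simp add: ge_one_powr_ge_zero)
  finally show ?thesis .
qed

text \<open>
  The derivatives of positive order along unit vectors are at most \<open>\<bar>B\<bar> \<omega>^k\<close>. In the Hoelder condition the
  factor \<open>\<omega>^l\<close> of the \<open>l\<close>-th derivative and the factor \<open>\<omega>^(\<beta> - l)\<close> coming from
  \<open>cos_Hoelder\<close> combine to \<open>\<omega>^\<beta>\<close>.
\<close>
lemma axis_wave_in_smooth_class:
  fixes i :: "'n::finite"
  assumes "\<beta> \<ge> 1" and "\<omega> > 0"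
    and L_nonneg: "\<And>k. k \<le> smoothness_order \<beta> \<Longrightarrow> 0 \<le> L k"
    and L0: "\<bar>A\<bar> + \<bar>B\<bar> \<le> L 0"
    and Lk: "\<And>k. 1 \<le> k \<Longrightarrow> k \<le> smoothness_order \<beta> \<Longrightarrow> \<bar>B\<bar> * \<omega> ^ k \<le> L k"
    and L\<beta>: "2 * \<bar>B\<bar> * \<omega> powr \<beta> \<le> L\<beta>"
  shows "(\<lambda>x::real^'n. (A + B * cos (\<omega> * (x $ i - y0))) *\<^sub>R axis i 1) \<in> smooth_class \<beta> L L\<beta>"
  unfolding smooth_class_def Let_def mem_Collect_eq
proof (rule allI)
  fix j :: 'n
  define l where "l = smoothness_order \<beta>"
  define A' where "A' = (if j = i then A else 0)"
  define B' where "B' = (if j = i then B else 0)"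
  \<comment> \<open>The components across the axis vanish, and zero is the wave with both coefficients zero.\<close>
  have comp: "(\<lambda>x::real^'n. ((A + B * cos (\<omega> * (x $ i - y0))) *\<^sub>R axis i 1) $ j)
      = (\<lambda>x. A' + B' * cos (\<omega> * (x $ i - y0)))"
    by (auto simp: A'_def B'_def axis_def)
  let ?g = "\<lambda>x::real^'n. A' + B' * cos (\<omega> * (x $ i - y0))"
  have iter: "iter_deriv ?g x vs = (if vs = [] then A' else 0)
      + B' * \<omega> ^ length vs * prod_list (map (\<lambda>v. v $ i) vs)
            * cos (\<omega> * (x $ i - y0) + real (length vs) * (pi / 2))" for x vs
    by (simp add: iter_deriv_def iter_deriv_wave)
  have smooth: "times_differentiable l ?g"
    unfolding times_differentiable_def iter
  proof (intro allI impI)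
    fix vs :: "(real^'n) list" and x :: "real^'n"
    show "(\<lambda>y::real^'n. (if vs = [] then A' else 0)
      + B' * \<omega> ^ length vs * prod_list (map (\<lambda>v. v $ i) vs)
            * cos (\<omega> * (y $ i - y0) + real (length vs) * (pi / 2))) differentiable at x"
      unfolding differentiable_def using axis_wave_has_derivative by blast
  qed
  have bounds: "(SUP x. form_op_norm k (iter_deriv ?g x)) \<le> ereal (L k)" if "k \<le> l" for k
    unfolding form_op_norm_def
  proof (intro SUP_least, clarsimp)
    fix x :: "real^'n" and vs :: "(real^'n) list"
    assume k: "k = length vs" and unit: "\<forall>v\<in>set vs. norm v = 1"
    show "\<bar>iter_deriv ?g x vs\<bar> \<le> L (length vs)"
    proof (cases "vs = []")
      case True
      have "\<bar>A' + B' * cos (\<omega> * (x $ i - y0))\<bar> \<le> \<bar>A'\<bar> + \<bar>B'\<bar> * 1"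
        by (rule order_trans[OF abs_triangle_ineq])
          (simp add: abs_mult mult_left_le)
      also have "\<dots> \<le> L 0" using L0 L_nonneg[of 0] by (auto simp: A'_def B'_def)
      finally show ?thesis using True by (simp add: iter)
    next
      case False
      have "\<bar>iter_deriv ?g x vs\<bar> = \<bar>B'\<bar> * \<omega> ^ k * \<bar>prod_list (map (\<lambda>v. v $ i) vs)\<bar>
          * \<bar>cos (\<omega> * (x $ i - y0) + real (length vs) * (pi / 2))\<bar>"
        using False \<open>\<omega> > 0\<close> by (simp add: iter abs_mult k)
      also have "\<dots> \<le> \<bar>B'\<bar> * \<omega> ^ k * 1 * 1"
        using \<open>\<omega> > 0\<close> unit by (intro mult_mono abs_prod_list_components_le_1) auto
      also have "\<dots> \<le> L k"
        using Lk[of k] L_nonneg[of k] False that by (auto simp: B'_def k l_def Suc_le_eq)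
      finally show ?thesis by (simp add: k)
    qed
  qed
  have hoelder: "form_op_norm l (\<lambda>vs. iter_deriv ?g x vs - iter_deriv ?g y vs)
      \<le> ereal (L\<beta> * norm (x - y) powr (\<beta> - real l))" for x y
    unfolding form_op_norm_def
  proof (intro SUP_least, clarsimp)
    fix vs :: "(real^'n) list"
    assume l: "l = length vs" and unit: "\<forall>v\<in>set vs. norm v = 1"
    define \<gamma> where "\<gamma> = \<beta> - real l"
    have \<gamma>: "0 < \<gamma>" "\<gamma> \<le> 1"
      using smoothness_order_bounds[OF \<open>\<beta> \<ge> 1\<close>] by (auto simp: \<gamma>_def l_def)
    define c where "c = real l * (pi / 2)"
    have "\<bar>iter_deriv ?g x vs - iter_deriv ?g y vs\<bar> = \<bar>B'\<bar> * \<omega> ^ l *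
        \<bar>prod_list (map (\<lambda>v. v $ i) vs)\<bar> *
        \<bar>cos (\<omega> * (x $ i - y0) + c) - cos (\<omega> * (y $ i - y0) + c)\<bar>"
    proof -
      have "iter_deriv ?g x vs - iter_deriv ?g y vs = B' * \<omega> ^ l *
        prod_list (map (\<lambda>v. v $ i) vs) *
        (cos (\<omega> * (x $ i - y0) + c) - cos (\<omega> * (y $ i - y0) + c))"
        unfolding iter l c_def by (simp add: right_diff_distrib)
      then show ?thesis using \<open>\<omega> > 0\<close> by (simp add: abs_mult)
    qed
    also have "\<dots> \<le> \<bar>B'\<bar> * \<omega> ^ l * 1 * (2 * (\<omega> * norm (x - y)) powr \<gamma>)"
    proof (intro mult_mono abs_prod_list_components_le_1)
      have "\<bar>cos (\<omega> * (x $ i - y0) + c) - cos (\<omega> * (y $ i - y0) + c)\<bar>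
          \<le> 2 * \<bar>(\<omega> * (x $ i - y0) + c) - (\<omega> * (y $ i - y0) + c)\<bar> powr \<gamma>"
        using \<gamma> by (intro cos_Hoelder) auto
      also have "\<bar>(\<omega> * (x $ i - y0) + c) - (\<omega> * (y $ i - y0) + c)\<bar> = \<omega> * \<bar>(x - y) $ i\<bar>"
      proof -
        have "(\<omega> * (x $ i - y0) + c) - (\<omega> * (y $ i - y0) + c) = \<omega> * (x - y) $ i"
          by (simp add: algebra_simps)
        then show ?thesis using \<open>\<omega> > 0\<close> by (simp only: abs_mult abs_of_pos)
      qed
      also have "2 * (\<omega> * \<bar>(x - y) $ i\<bar>) powr \<gamma> \<le> 2 * (\<omega> * norm (x - y)) powr \<gamma>"
        using \<gamma> \<open>\<omega> > 0\<close> component_le_norm_cart[of "x - y" i]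
        by (intro mult_left_mono powr_mono2) auto
      finally show "\<bar>cos (\<omega> * (x $ i - y0) + c) - cos (\<omega> * (y $ i - y0) + c)\<bar>
        \<le> 2 * (\<omega> * norm (x - y)) powr \<gamma>" .
    qed (use unit \<open>\<omega> > 0\<close> in auto)
    also have "\<dots> = 2 * \<bar>B'\<bar> * \<omega> powr \<beta> * norm (x - y) powr \<gamma>"
    proof -
      have "\<omega> ^ l * \<omega> powr \<gamma> = \<omega> powr \<beta>"
        using \<open>\<omega> > 0\<close> by (simp add: \<gamma>_def powr_diff powr_realpow)
      then show ?thesis using \<open>\<omega> > 0\<close> by (simp add: powr_mult)
    qed
    also have "\<dots> \<le> L\<beta> * norm (x - y) powr \<gamma>"
    proof (rule mult_right_mono)
      have "0 \<le> 2 * \<bar>B\<bar> * \<omega> powr \<beta>" by simp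
      with L\<beta> have "0 \<le> L\<beta>" by linarith
      with L\<beta> show "2 * \<bar>B'\<bar> * \<omega> powr \<beta> \<le> L\<beta>" by (simp add: B'_def)
    qed simp
    finally show "\<bar>iter_deriv ?g x vs - iter_deriv ?g y vs\<bar>
        \<le> L\<beta> * norm (x - y) powr (\<beta> - real (length vs))"
      by (simp add: \<gamma>_def l)
  qed
  show "times_differentiable (smoothness_order \<beta>)
          (\<lambda>x::real^'n. ((A + B * cos (\<omega> * (x $ i - y0))) *\<^sub>R axis i 1) $ j) \<and>
        (\<forall>k\<le>smoothness_order \<beta>. (SUP x. form_op_norm k
          (iter_deriv (\<lambda>x::real^'n. ((A + B * cos (\<omega> * (x $ i - y0))) *\<^sub>R axis i 1) $ j) x))
          \<le> ereal (L k)) \<and>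
        (\<forall>x y. form_op_norm (smoothness_order \<beta>) (\<lambda>vs.
          iter_deriv (\<lambda>x::real^'n. ((A + B * cos (\<omega> * (x $ i - y0))) *\<^sub>R axis i 1) $ j) x vs -
          iter_deriv (\<lambda>x::real^'n. ((A + B * cos (\<omega> * (x $ i - y0))) *\<^sub>R axis i 1) $ j) y vs)
          \<le> ereal (L\<beta> * norm (x - y) powr (\<beta> - real (smoothness_order \<beta>))))"
    unfolding comp using smooth bounds hoelder by (simp add: l_def)
qed

section \<open>Flows along a line with a prescribed hitting time\<close>

lemma has_vector_derivative_zero_imp_eq:
  fixes u :: "real \<Rightarrow> 'a::real_normed_vector"
  assumes "\<And>t. (u has_vector_derivative 0) (at t)"
  shows "u s = u t"
  using has_vector_derivative_zero_constant[of UNIV u] assms by (metis UNIV_I convex_UNIV)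

text \<open>
  The function \<open>T\<close> is a clock: since \<open>T' = 1 / g\<close>, it grows at unit rate along every solution.
  Inverting it produces a solution on the whole real line, and reading it along an arbitrary solution
  shows that there is no other one. In particular the flow at time \<open>t\<close> is determined by the
  single equation \<open>T s = t + T (x \<bullet> e)\<close>.
\<close>
lemma ode_flow_along_line:
  fixes g T :: "real \<Rightarrow> real" and e x :: "'a::real_inner"
  assumes e: "norm e = 1"
    and pos: "\<And>y. g y > 0"
    and T: "\<And>y. (T has_real_derivative inverse (g y)) (at y)"
    and surj: "surj T"
    and s: "T s = t + T (x \<bullet> e)"
  shows "ode_flow (\<lambda>x. g (x \<bullet> e) *\<^sub>R e) x t = x + (s - x \<bullet> e) *\<^sub>R e"
proof -
  have ee: "e \<bullet> e = 1" using e by (simp add: norm_eq_1)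
  have "strict_mono T"
  proof (rule strict_monoI)
    fix y z :: real assume "y < z"
    moreover have "\<exists>d. (T has_real_derivative d) (at r) \<and> d > 0" for r
      using T[of r] pos[of r] by (intro exI[of _ "inverse (g r)"]) simp
    ultimately show "T y < T z" by (rule DERIV_pos_imp_increasing)
  qed
  then have inj: "inj T" by (rule strict_mono_imp_inj_on)
  define S where "S = inv T"
  have ST: "S (T y) = y" and TS: "T (S r) = r" for y r
    using inj surj by (auto simp: S_def surj_f_inv_f)
  have contT: "continuous_on UNIV T"
    using T by (intro continuous_at_imp_continuous_on) (auto intro: DERIV_isCont)
  have dS: "(S has_real_derivative g (S r)) (at r)" for r
  proof -
    have "(S has_derivative (\<lambda>h. h * g (S r))) (at (T (S r)))"
    proof (rule has_derivative_inverse_strong[where S = UNIV and f = T])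
      show "(T has_derivative (\<lambda>h. h * inverse (g (S r)))) (at (S r))"
        using T[of "S r"] by (simp add: has_field_derivative_def mult_commute_abs)
      show "(\<lambda>h. h * inverse (g (S r))) \<circ> (\<lambda>h. h * g (S r)) = id"
        using pos[of "S r"] by (auto simp: fun_eq_iff)
    qed (use contT ST in auto)
    then show ?thesis by (simp add: TS has_field_derivative_def mult_commute_abs)
  qed
  define u where "u = (\<lambda>r. x + (S (r + T (x \<bullet> e)) - x \<bullet> e) *\<^sub>R e)"
  have ue: "u r \<bullet> e = S (r + T (x \<bullet> e))" for r
    by (simp add: u_def inner_add_left ee)
  have u0: "u 0 = x" by (simp add: u_def ST)
  have du: "(u has_vector_derivative g (u r \<bullet> e) *\<^sub>R e) (at r)" for r
  proof -
    have "((\<lambda>r. S (r + T (x \<bullet> e))) has_real_derivative g (S (r + T (x \<bullet> e)))) (at r)"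
    proof -
      have "((\<lambda>r. r + T (x \<bullet> e)) has_real_derivative 1) (at r)"
        by (auto intro!: derivative_eq_intros)
      from DERIV_chain2[OF dS this] show ?thesis by simp
    qed
    then show ?thesis unfolding ue unfolding u_def by (auto intro!: derivative_eq_intros)
  qed
  have uniq: "v = u"
    if v0: "v 0 = x" and dv: "\<And>r. (v has_vector_derivative g (v r \<bullet> e) *\<^sub>R e) (at r)" for v
  proof
    fix r
    \<comment> \<open>The part of \<open>v\<close> orthogonal to \<open>e\<close> stays fixed, and \<open>T\<close> of the other part
      runs like the time.\<close>
    have dve: "((\<lambda>r. v r \<bullet> e) has_vector_derivative g (v r \<bullet> e)) (at r)" for r
      using bounded_linear.has_vector_derivative[OF bounded_linear_inner_left dv, of e r]
      by (simp add: ee)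
    have "((\<lambda>r. v r - (v r \<bullet> e) *\<^sub>R e) has_vector_derivative 0) (at r)" for r
    proof -
      have "((\<lambda>r. (v r \<bullet> e) *\<^sub>R e) has_vector_derivative g (v r \<bullet> e) *\<^sub>R e) (at r)"
        by (rule bounded_linear.has_vector_derivative[OF bounded_linear_scaleR_left dve])
      from has_vector_derivative_diff[OF dv this] show ?thesis by simp
    qed
    then have orth: "v r - (v r \<bullet> e) *\<^sub>R e = x - (x \<bullet> e) *\<^sub>R e"
      using has_vector_derivative_zero_imp_eq[of "\<lambda>r. v r - (v r \<bullet> e) *\<^sub>R e" r 0] v0 by simp
    have "((\<lambda>r. T (v r \<bullet> e) - r) has_real_derivative 0) (at r)" for r
      using DERIV_diff[OF DERIV_chain2[OF T dve[unfolded
            has_real_derivative_iff_has_vector_derivative[symmetric]]] DERIV_ident, of r]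
        pos[of "v r \<bullet> e"] by simp
    then have "T (v r \<bullet> e) - r = T (v 0 \<bullet> e) - 0"
      by (intro DERIV_isconst_all) auto
    then have "v r \<bullet> e = S (r + T (x \<bullet> e))"
      using ST[of "v r \<bullet> e"] by (simp add: v0 algebra_simps)
    with orth show "v r = u r" by (simp add: u_def algebra_simps)
  qed
  have "ode_flow (\<lambda>x. g (x \<bullet> e) *\<^sub>R e) x = u"
    unfolding ode_flow_def
  proof (rule the_equality)
    show "u 0 = x \<and> (\<forall>r. (u has_vector_derivative g (u r \<bullet> e) *\<^sub>R e) (at r))"
      using u0 du by blast
  qed (use uniq in blast)
  moreover have "S (t + T (x \<bullet> e)) = s" using ST[of s] unfolding s .
  ultimately show ?thesis by (simp add: u_def)
qed

section \<open>The Poisson kernel as reciprocal speed\<close>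

text \<open>
  The reciprocal of this function is the Poisson kernel of the unit disc at the point \<open>- q\<close>,
  divided by \<open>b\<close> (see \<open>poisson_speed_eq\<close>). The form below separates the constant from the
  oscillating part.
\<close>
definition poisson_speed :: "real \<Rightarrow> real \<Rightarrow> real \<Rightarrow> real" where
  "poisson_speed b q z = b * (1 + q\<^sup>2) / (1 - q\<^sup>2) + 2 * b * q / (1 - q\<^sup>2) * cos z"

text \<open>
  The time needed to reach the phase \<open>z\<close> at speed \<open>poisson_speed b q\<close>. The quotient inside
  \<open>arctan\<close> is the tangent of the argument of \<open>1 + q e^(i z)\<close>, a point of the right half
  plane, so no branch of \<open>arctan\<close> is ever crossed and the formula is smooth on the whole line.
\<close>
definition poisson_time :: "real \<Rightarrow> real \<Rightarrow> real \<Rightarrow> real" where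
  "poisson_time b q z = (z - 2 * arctan (q * sin z / (1 + q * cos z))) / b"

lemma one_plus_cos_pos:
  fixes q z :: real
  assumes "\<bar>q\<bar> < 1"
  shows "1 + q * cos z > 0"
proof -
  have "\<bar>q * cos z\<bar> \<le> \<bar>q\<bar> * 1" unfolding abs_mult by (intro mult_left_mono) auto
  with assms show ?thesis by linarith
qed

text \<open>Both sides are the squared modulus of \<open>1 + q e^(i z)\<close>.\<close>
lemma poisson_denominator:
  fixes q z :: real
  shows "(1 + q * cos z)\<^sup>2 + (q * sin z)\<^sup>2 = 1 + q\<^sup>2 + 2 * q * cos z"
proof -
  have "(q * cos z)\<^sup>2 + (q * sin z)\<^sup>2 = q\<^sup>2"
    by (simp add: power_mult_distrib flip: distrib_left)
  then show ?thesis by (simp add: power2_sum)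
qed

lemma poisson_speed_eq:
  "poisson_speed b q z = b * (1 + q\<^sup>2 + 2 * q * cos z) / (1 - q\<^sup>2)"
proof -
  have "b * (1 + q\<^sup>2) / (1 - q\<^sup>2) + 2 * b * q / (1 - q\<^sup>2) * cos z
      = (b * (1 + q\<^sup>2) + 2 * b * q * cos z) / (1 - q\<^sup>2)"
    by (simp add: add_divide_distrib)
  then show ?thesis by (simp add: poisson_speed_def algebra_simps)
qed

lemma poisson_denominator_pos:
  fixes q z :: real
  assumes "\<bar>q\<bar> < 1"
  shows "1 + q\<^sup>2 + 2 * q * cos z > 0"
  using one_plus_cos_pos[OF assms, of z] 
  by (simp flip: poisson_denominator add: add_pos_nonneg)

lemma poisson_speed_pos:
  assumes "b > 0" "\<bar>q\<bar> < 1"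
  shows "poisson_speed b q z > 0"
  using assms poisson_denominator_pos[of q z]
  by (simp add: poisson_speed_eq abs_square_less_1)

lemma poisson_time_has_derivative:
  assumes "b > 0" "\<bar>q\<bar> < 1"
  shows "(poisson_time b q has_real_derivative inverse (poisson_speed b q z)) (at z)"
proof -
  define c s where "c = cos z" and "s = sin z"
  define N where "N = 1 + q\<^sup>2 + 2 * q * c"
  have cs: "c * c + s * s = 1"
    by (simp add: c_def s_def flip: power2_eq_square)
  have c1: "1 + q * c \<noteq> 0" using one_plus_cos_pos[OF assms(2), of z] by (simp add: c_def)
  have N: "N > 0" using poisson_denominator_pos[OF assms(2)] by (simp add: N_def c_def)
  have numer: "(q * c) * (1 + q * c) - (q * s) * (- (q * s)) = q * (c + q)"
  proof -
    have "(q * c) * (1 + q * c) - (q * s) * (- (q * s)) = q * c + q * q * (c * c + s * s)"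
      by (simp add: algebra_simps)
    then show ?thesis by (simp add: cs algebra_simps)
  qed
  have frac: "((\<lambda>z. q * sin z / (1 + q * cos z)) has_real_derivative
      (q * (c + q)) / (1 + q * c)\<^sup>2) (at z)"
    unfolding numer[symmetric] using c1
    by (auto intro!: derivative_eq_intros simp: c_def s_def power2_eq_square mult.commute)
  have den: "1 + (q * s / (1 + q * c))\<^sup>2 = N / (1 + q * c)\<^sup>2"
    using c1 poisson_denominator[of q z] by (simp add: N_def c_def s_def power_divide add_divide_eq_iff)
  have "((\<lambda>z. arctan (q * sin z / (1 + q * cos z))) has_real_derivative
      inverse (1 + (q * s / (1 + q * c))\<^sup>2) * (q * (c + q) / (1 + q * c)\<^sup>2)) (at z)"
    using DERIV_chain2[OF DERIV_arctan frac] by (simp add: c_def s_def)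
  also have "inverse (1 + (q * s / (1 + q * c))\<^sup>2) * (q * (c + q) / (1 + q * c)\<^sup>2)
      = q * (c + q) / N"
    using c1 N by (simp add: den)
  finally have "((\<lambda>z. arctan (q * sin z / (1 + q * cos z))) has_real_derivative q * (c + q) / N) (at z)" .
  then have "(poisson_time b q has_real_derivative (1 - 2 * (q * (c + q) / N)) / b) (at z)"
    unfolding poisson_time_def[abs_def]
    by (intro DERIV_cdivide DERIV_diff DERIV_ident DERIV_cmult)
  also have "1 - 2 * (q * (c + q) / N) = (1 - q\<^sup>2) / N"
    using N by (simp add: N_def field_simps power2_eq_square)
  also have "(1 - q\<^sup>2) / N / b = inverse (poisson_speed b q z)"
    by (simp add: poisson_speed_eq N_def c_def field_simps)
  finally show ?thesis .
qed

text \<open>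
  The \<open>arctan\<close> term is periodic, so a full period takes the same time as at the constant speed
  \<open>b\<close>, whatever \<open>q\<close> is. This is where the dependence on \<open>q\<close> disappears from the flow at
  the observation times.
\<close>
lemma poisson_time_periodic:
  "poisson_time b q (z + 2 * pi * of_int k) = poisson_time b q z + 2 * pi * of_int k / b"
proof -
  have "cos (z + 2 * pi * of_int k) = cos z" "sin (z + 2 * pi * of_int k) = sin z"
    using sin_cos_eq_iff by blast+
  then show ?thesis by (simp add: poisson_time_def diff_divide_distrib add_divide_distrib)
qed

text \<open>The bounded \<open>arctan\<close> term cannot keep the linear term from reaching every value.\<close>
lemma surj_poisson_time:
  assumes "b > 0" "\<bar>q\<bar> < 1"
  shows "surj (poisson_time b q)"
proof -
  have "\<exists>z. poisson_time b q z = r" for r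
  proof -
  have lt: "b * poisson_time b q z \<le> z + pi" "z - pi \<le> b * poisson_time b q z" for z
    using arctan_bounded[of "q * sin z / (1 + q * cos z)"] assms
    by (auto simp: poisson_time_def)
  have "poisson_time b q (b * r - pi) \<le> r" "r \<le> poisson_time b q (b * r + pi)"
    using lt(1)[of "b * r - pi"] lt(2)[of "b * r + pi"] assms by auto
  moreover have "isCont (poisson_time b q) z" for z
    using poisson_time_has_derivative[OF assms] by (rule DERIV_isCont)
  ultimately show ?thesis
    using IVT[of "poisson_time b q" "b * r - pi" r "b * r + pi"] by auto
  qed
  then show ?thesis unfolding surj_def by metis
qed

text \<open>
  The wavelength \<open>2 pi / \<omega>\<close> is the distance \<open>b \<Delta>t\<close>, so \<open>k \<Delta>t\<close> is exactly the time for
  crossing \<open>k\<close> periods. The right-hand side does not involve \<open>q\<close>.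
\<close>
lemma ode_flow_poisson_stroboscopic:
  fixes i :: "'n::finite" and x :: "real^'n"
  assumes "b > 0" "\<bar>q\<bar> < 1" "\<Delta>t > 0"
  defines "\<omega> \<equiv> 2 * pi / (b * \<Delta>t)"
  shows "ode_flow (\<lambda>x. poisson_speed b q (\<omega> * (x $ i - y0)) *\<^sub>R axis i 1) x (of_int k * \<Delta>t)
    = x + (of_int k * (b * \<Delta>t)) *\<^sub>R axis i 1"
proof -
  have \<omega>: "\<omega> > 0" using assms by (simp add: \<omega>_def)
  define T where "T = (\<lambda>y. poisson_time b q (\<omega> * (y - y0)) / \<omega>)"
  have dT: "(T has_real_derivative inverse (poisson_speed b q (\<omega> * (y - y0)))) (at y)" for y
  proof -
    have "((\<lambda>y. \<omega> * (y - y0)) has_real_derivative \<omega>) (at y)"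
      by (auto intro!: derivative_eq_intros)
    from DERIV_cdivide[OF DERIV_chain2[OF poisson_time_has_derivative[OF assms(1,2)] this], of \<omega>]
    show ?thesis using \<omega> by (simp add: T_def)
  qed
  have "\<exists>y. T y = r" for r
  proof -
    obtain z where "poisson_time b q z = r * \<omega>"
      using surj_poisson_time[OF assms(1,2)] by (metis surjD)
    then have "T (z / \<omega> + y0) = r" using \<omega> by (simp add: T_def)
    then show ?thesis by blast
  qed
  then have surj: "surj T" unfolding surj_def by metis
  have period: "T (x $ i + of_int k * (b * \<Delta>t)) = of_int k * \<Delta>t + T (x $ i)"
  proof -
    have "\<omega> * (x $ i + of_int k * (b * \<Delta>t) - y0) = \<omega> * (x $ i - y0) + 2 * pi * of_int k"
      using assms by (simp add: \<omega>_def field_simps)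
    then have "T (x $ i + of_int k * (b * \<Delta>t)) = T (x $ i) + 2 * pi * of_int k / b / \<omega>"
      by (simp add: T_def poisson_time_periodic add_divide_distrib)
    also have "2 * pi * of_int k / b / \<omega> = of_int k * \<Delta>t"
      using assms by (simp add: \<omega>_def field_simps)
    finally show ?thesis by simp
  qed
  have nth: "y $ i = y \<bullet> axis i 1" for y :: "real^'n"
    by (simp add: inner_axis)
  show ?thesis
    using ode_flow_along_line[of "axis i 1 :: real^'n" "\<lambda>y. poisson_speed b q (\<omega> * (y - y0))" T,
        OF _ poisson_speed_pos[OF assms(1,2)] dT surj period[unfolded nth]]
    by (simp add: nth[symmetric])
qed

section \<open>The oscillation in the \<open>L^p\<close> norm\<close>

text \<open>
  The integrand on the cube is a product of functions of the single coordinates, all but one of which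
  are indicators of the unit interval.
\<close>
lemma set_integral_unit_cube_component:
  fixes h :: "real \<Rightarrow> real" and i :: "'n::finite"
  assumes h: "continuous_on UNIV h" and nonneg: "\<And>s. h s \<ge> 0"
  shows "(LINT x:(cbox 0 1 :: (real^'n) set)|lborel. h (x $ i)) = integral {0..1} h"
proof -
  have [measurable]: "h \<in> borel_measurable borel"
    using h by (rule borel_measurable_continuous_onI)
  define e where "e = (axis i 1 :: real^'n)"
  have e: "e \<in> Basis" by (simp add: e_def)
  define f where "f = (\<lambda>(b::real^'n) s. indicator {0..1} s * (if b = e then h s else 1))"
  have one: "(1 :: real^'n) \<bullet> b = 1" if "b \<in> Basis" for b
    using that by (auto simp: Basis_vec_def inner_axis)
  have prod: "indicator (cbox 0 1) x * h (x $ i) = (\<Prod>b\<in>Basis. f b (x \<bullet> b))" for x :: "real^'n"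
  proof -
    have "(\<Prod>b\<in>Basis. f b (x \<bullet> b)) = (\<Prod>b\<in>Basis. indicator {0..1} (x \<bullet> b))
        * (\<Prod>b\<in>Basis. if b = e then h (x \<bullet> b) else 1)"
      by (simp add: f_def prod.distrib)
    also have "(\<Prod>b\<in>Basis. if b = e then h (x \<bullet> b) else 1) = h (x $ i)"
      using e by (subst prod.delta) (auto simp: e_def inner_axis)
    also have "(\<Prod>b\<in>Basis. indicator {0..1} (x \<bullet> b)) = (indicator (cbox 0 1) x :: real)"
    proof (cases "x \<in> cbox 0 1")
      case True
      then show ?thesis by (auto simp: mem_box one intro!: prod.neutral)
    next
      case False
      then obtain b :: "real^'n" where "b \<in> Basis" "x \<bullet> b \<notin> {0..1}"
        by (auto simp: mem_box one)
      then have "indicator {0..1} (x \<bullet> b) = (0::real)" by simp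
      with \<open>b \<in> Basis\<close> False show ?thesis by (auto intro!: prod_zero)
    qed
    finally show ?thesis by simp
  qed
  have int: "h integrable_on {0..1}"
    using h by (intro integrable_continuous_interval) (auto intro: continuous_on_subset)
  have nn: "(\<integral>\<^sup>+s. f b s \<partial>lborel) = (if b = e then ennreal (integral {0..1} h) else 1)" for b
  proof (cases "b = e")
    case True
    have "((\<lambda>s. indicator {0..1} s * h s) has_integral integral {0..1} h) UNIV"
    proof -
      have "(\<lambda>s. indicator {0..1} s * h s) = (\<lambda>s. if s \<in> {0..1} then h s else 0)"
        by (auto simp: indicator_def)
      then show ?thesis
        using integrable_integral[OF int] by (simp only: has_integral_restrict_UNIV)
    qed
    from nn_integral_has_integral_lborel[OF _ _ this] show ?thesis
      using True nonneg by (simp add: f_def)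
  next
    case False
    then show ?thesis by (simp add: f_def ennreal_indicator)
  qed
  have "(\<integral>\<^sup>+x. ennreal (indicator (cbox 0 1) x * h ((x :: real^'n) $ i)) \<partial>lborel)
      = (\<Prod>b\<in>Basis. (\<integral>\<^sup>+s. f b s \<partial>lborel))"
    unfolding prod
    by (subst nn_integral_lborel_prod[symmetric]) (auto simp: f_def nonneg prod_ennreal)
  also have "\<dots> = ennreal (integral {0..1} h)"
    unfolding nn using e by (subst prod.delta) auto
  finally have "(\<integral>\<^sup>+x. ennreal (indicator (cbox 0 1) x * h ((x :: real^'n) $ i)) \<partial>lborel)
      = ennreal (integral {0..1} h)" .
  moreover have "integral {0..1} h \<ge> 0" using int nonneg by (intro integral_nonneg) auto
  ultimately show ?thesis
    unfolding set_lebesgue_integral_def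
    by (subst integral_eq_nn_integral) (auto simp: nonneg)
qed

text \<open>
  Write \<open>w\<close> for \<open>q + cos z\<close>. The mean of \<open>w cos z\<close> is about \<open>1 / 2\<close>, and it stays above
  \<open>1 / 4\<close> after the boundary terms are accounted for, if the frequency is at least \<open>6\<close>. As
  \<open>w cos z \<le> \<bar>w\<bar> \<le> 2\<close>, the elementary function \<open>(1/8)^p (w cos z - 1/8) / 2\<close> lies below
  \<open>\<bar>w\<bar>^p\<close>: it is negative where \<open>\<bar>w\<bar> < 1/8\<close> and at most \<open>(1/8)^p\<close> elsewhere. Integrating
  this minorant by its explicit primitive gives the bound.
\<close>
lemma integral_abs_shifted_cos_powr_ge:
  fixes q \<omega> p y0 :: real
  assumes q: "0 \<le> q" "q \<le> 1 / 2" and \<omega>: "\<omega> \<ge> 6" and p: "p \<ge> 1"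
  shows "integral {0..1} (\<lambda>s. \<bar>q + cos (\<omega> * (s - y0))\<bar> powr p) \<ge> (1 / 8) powr p / 16"
proof -
  let ?z = "\<lambda>s. \<omega> * (s - y0)"
  let ?w = "\<lambda>s. q + cos (?z s)"
  \<comment> \<open>A primitive of the minorant.\<close>
  define F where "F = (\<lambda>s. (1 / 8) powr p / 2 *
      (s / 2 + sin (2 * ?z s) / (4 * \<omega>) + q * sin (?z s) / \<omega> - s / 8))"
  have "(F has_real_derivative (1 / 8) powr p / 2 * (?w s * cos (?z s) - 1 / 8)) (at s)" for s
  proof -
    have "(F has_real_derivative (1 / 8) powr p / 2 *
        (1 / 2 + cos (2 * ?z s) / 2 + q * cos (?z s) - 1 / 8)) (at s)"
      unfolding F_def using \<omega> by (auto intro!: derivative_eq_intros simp: field_simps)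
    also have "1 / 2 + cos (2 * ?z s) / 2 + q * cos (?z s) - 1 / 8 = ?w s * cos (?z s) - 1 / 8"
      unfolding cos_double_cos by (simp add: field_simps power2_eq_square)
    finally show ?thesis .
  qed
  then have lower: "((\<lambda>s. (1 / 8) powr p / 2 * (?w s * cos (?z s) - 1 / 8)) has_integral F 1 - F 0) {0..1}"
    by (intro fundamental_theorem_of_calculus)
      (auto simp flip: has_real_derivative_iff_has_vector_derivative intro: has_field_derivative_at_within)
  have int: "(\<lambda>s. \<bar>?w s\<bar> powr p) integrable_on {0..1}"
    using p by (intro integrable_continuous_interval continuous_on_powr' continuous_intros) auto
  have pointwise: "(1 / 8) powr p / 2 * (?w s * cos (?z s) - 1 / 8) \<le> \<bar>?w s\<bar> powr p" for s
  proof -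
    have "?w s * cos (?z s) \<le> \<bar>?w s\<bar> * \<bar>cos (?z s)\<bar>"
      by (simp flip: abs_mult)
    also have "\<dots> \<le> \<bar>?w s\<bar>" by (simp add: mult_left_le)
    finally have wc: "?w s * cos (?z s) \<le> \<bar>?w s\<bar>" .
    have w2: "\<bar>?w s\<bar> \<le> 2" using q abs_cos_le_one[of "?z s"] by linarith
    show ?thesis
    proof (cases "\<bar>?w s\<bar> \<ge> 1 / 8")
      case True
      have "(1 / 8) powr p / 2 * (?w s * cos (?z s) - 1 / 8) \<le> (1 / 8) powr p / 2 * 2"
        using wc w2 by (intro mult_left_mono) auto
      also have "\<dots> \<le> \<bar>?w s\<bar> powr p" using True p by (simp add: powr_mono2)
      finally show ?thesis .
    next
      case False
      then have "(1 / 8) powr p / 2 * (?w s * cos (?z s) - 1 / 8) \<le> 0"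
        using wc by (intro mult_nonneg_nonpos) auto
      then show ?thesis using powr_ge_zero[of "\<bar>?w s\<bar>" p] by linarith
    qed
  qed
  have small: "\<bar>sin z / \<omega>\<bar> \<le> 1 / 6" for z
    using frac_le[OF _ abs_sin_le_one[of z] _ \<omega>] \<omega> by simp
  have qsmall: "\<bar>q * (sin z / \<omega>)\<bar> \<le> 1 / 12" for z
    unfolding abs_mult using mult_mono[OF _ small[of z], of "\<bar>q\<bar>" "1 / 2"] q by simp
  have "F 1 - F 0 = (1 / 8) powr p / 2 * (3 / 8
      + (sin (2 * ?z 1) / \<omega> - sin (2 * ?z 0) / \<omega>) / 4
      + (q * (sin (?z 1) / \<omega>) - q * (sin (?z 0) / \<omega>)))"
    by (simp add: F_def algebra_simps)
  also have "\<dots> \<ge> (1 / 8) powr p / 2 * (1 / 8)"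
  proof (rule mult_left_mono)
    have arith: "1 / 8 \<le> 3 / 8 + (u - v) / 4 + (u' - v')"
      if "- u \<le> 1 / 6" "v \<le> 1 / 6" "- u' \<le> 1 / 12" "v' \<le> 1 / 12" for u v u' v' :: real
      using that by (simp add: field_simps)
    show "1 / 8 \<le> 3 / 8 + (sin (2 * ?z 1) / \<omega> - sin (2 * ?z 0) / \<omega>) / 4
      + (q * (sin (?z 1) / \<omega>) - q * (sin (?z 0) / \<omega>))"
      by (intro arith abs_le_D2[OF small] abs_le_D1[OF small] abs_le_D2[OF qsmall] abs_le_D1[OF qsmall])
  qed simp
  finally have "(1 / 8) powr p / 16 \<le> F 1 - F 0" by simp
  also have "\<dots> \<le> integral {0..1} (\<lambda>s. \<bar>?w s\<bar> powr p)"
    using has_integral_le[OF lower integrable_integral[OF int] pointwise] by simp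
  finally show ?thesis .
qed

text \<open>
  The factor \<open>1 / 16\<close> of the preceding bound is weakened to \<open>(1 / 16)^p\<close>, so that taking the
  \<open>p\<close>-th root leaves \<open>1 / (8 * 16) = 1 / 128\<close> for every \<open>p\<close>.
\<close>
lemma Lp_norm_shifted_cos_wave_ge:
  fixes i :: "'n::finite"
  assumes "0 \<le> q" "q \<le> 1 / 2" "\<omega> \<ge> 6" "p \<ge> 1" "B \<ge> 0"
  shows "Lp_norm_on p (cbox 0 1) (\<lambda>x::real^'n. \<bar>B * (q + cos (\<omega> * (x $ i - y0)))\<bar>) \<ge> B / 128"
proof -
  define I where "I = integral {0..1} (\<lambda>s. \<bar>q + cos (\<omega> * (s - y0))\<bar> powr p)"
  have I: "I \<ge> (1 / 8) powr p / 16"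
    unfolding I_def using assms by (intro integral_abs_shifted_cos_powr_ge) auto
  have "(LINT x:(cbox 0 1 :: (real^'n) set)|lborel. \<bar>\<bar>B * (q + cos (\<omega> * (x $ i - y0)))\<bar>\<bar> powr p)
      = integral {0..1} (\<lambda>s. \<bar>B * (q + cos (\<omega> * (s - y0)))\<bar> powr p)"
  proof (subst set_integral_unit_cube_component[symmetric, where i = i])
    show "continuous_on UNIV (\<lambda>s. \<bar>B * (q + cos (\<omega> * (s - y0)))\<bar> powr p)"
      using assms by (intro continuous_on_powr' continuous_intros) auto
  qed auto
  also have "\<dots> = B powr p * I"
    using assms by (simp add: I_def abs_mult powr_mult)
  finally have "Lp_norm_on p (cbox 0 1) (\<lambda>x::real^'n. \<bar>B * (q + cos (\<omega> * (x $ i - y0)))\<bar>)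
      = (B powr p * I) powr (1 / p)"
    by (simp add: Lp_norm_on_def)
  also have "\<dots> \<ge> (B powr p * ((1 / 8) powr p * (1 / 16) powr p)) powr (1 / p)"
  proof (intro powr_mono2 mult_left_mono)
    have "(1 / 16) powr p \<le> (1 / 16 :: real) powr 1" using assms by (intro powr_mono') auto
    then have "(1 / 8) powr p * (1 / 16) powr p \<le> (1 / 8) powr p * (1 / 16 :: real)"
      by (intro mult_left_mono) auto
    also have "\<dots> \<le> I" using I by simp
    finally show "(1 / 8) powr p * (1 / 16) powr p \<le> I" .
  qed (use assms in auto)
  also have "(B powr p * ((1 / 8) powr p * (1 / 16) powr p)) powr (1 / p) = B / 128"
    using assms by (simp add: powr_powr flip: powr_mult)
  finally show ?thesis .
qed

section \<open>Coefficients of the speed\<close>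

text \<open>
  The third bound is on the maximal speed, which is \<open>b (1 + q) / (1 - q)\<close>; the first two say that the
  amplitude of the oscillation is proportional to \<open>q\<close> up to constants.
\<close>
lemma poisson_coefficient_bounds:
  fixes b q :: real
  assumes "b > 0" "0 \<le> q" "q \<le> 1 / 2"
  shows "2 * b * q \<le> 2 * b * q / (1 - q\<^sup>2)"
    and "2 * b * q / (1 - q\<^sup>2) \<le> 3 * (b * q)"
    and "\<bar>b * (1 + q\<^sup>2) / (1 - q\<^sup>2)\<bar> + \<bar>2 * b * q / (1 - q\<^sup>2)\<bar> \<le> 3 * b"
proof -
  have q2: "q\<^sup>2 \<le> 1 / 4" using power_mono[OF assms(3,2), of 2] by (simp add: power_divide)
  have d: "1 - q\<^sup>2 > 0" using q2 by simp
  have bq: "b * q \<ge> 0" using assms by simp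
  have "2 * b * q * (1 - q\<^sup>2) \<le> 2 * b * q * 1"
    using bq by (intro mult_left_mono) auto
  then show "2 * b * q \<le> 2 * b * q / (1 - q\<^sup>2)"
    using d by (simp add: pos_le_divide_eq)
  have "b * q * (3 / 4) \<le> b * q * (1 - q\<^sup>2)"
    using bq q2 by (intro mult_left_mono) auto
  then have "2 * b * q \<le> 3 * (b * q) * (1 - q\<^sup>2)" using bq by linarith
  then show "2 * b * q / (1 - q\<^sup>2) \<le> 3 * (b * q)"
    using d by (simp add: pos_divide_le_eq)
  have "(1 + q)\<^sup>2 \<le> 3 * (1 - q\<^sup>2)"
  proof -
    have "0 \<le> (1 - 2 * q) * (1 + q)" using assms by simp
    then show ?thesis by (simp add: power2_eq_square algebra_simps)
  qed
  then have "b * (1 + q)\<^sup>2 \<le> 3 * b * (1 - q\<^sup>2)"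
    using mult_left_mono[of "(1 + q)\<^sup>2" "3 * (1 - q\<^sup>2)" b] assms(1) by (simp add: algebra_simps)
  then have "b * (1 + q)\<^sup>2 / (1 - q\<^sup>2) \<le> 3 * b"
    using d by (simp add: pos_divide_le_eq)
  moreover have "\<bar>b * (1 + q\<^sup>2) / (1 - q\<^sup>2)\<bar> + \<bar>2 * b * q / (1 - q\<^sup>2)\<bar>
      = b * (1 + q)\<^sup>2 / (1 - q\<^sup>2)"
  proof -
    have "b * (1 + q\<^sup>2) / (1 - q\<^sup>2) \<ge> 0" "2 * b * q / (1 - q\<^sup>2) \<ge> 0"
      using assms(1,2) d by auto
    then have "\<bar>b * (1 + q\<^sup>2) / (1 - q\<^sup>2)\<bar> + \<bar>2 * b * q / (1 - q\<^sup>2)\<bar>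
        = (b * (1 + q\<^sup>2) + 2 * b * q) / (1 - q\<^sup>2)"
      by (simp only: abs_of_nonneg add_divide_distrib)
    then show ?thesis by (simp add: power2_sum algebra_simps)
  qed
  ultimately show "\<bar>b * (1 + q\<^sup>2) / (1 - q\<^sup>2)\<bar> + \<bar>2 * b * q / (1 - q\<^sup>2)\<bar> \<le> 3 * b"
    by simp
qed

text \<open>
  Apart from its oscillation the speed with parameter \<open>q\<close> has a mean excess over \<open>b\<close>, which
  compensates for the longer time spent in the slow parts.
\<close>
lemma poisson_speed_deviation:
  assumes "\<bar>q\<bar> < 1"
  shows "poisson_speed b q z - poisson_speed b 0 z' = 2 * b * q / (1 - q\<^sup>2) * (q + cos z)"
proof -
  have d: "1 - q\<^sup>2 \<noteq> 0" using assms by (simp add: abs_square_less_1 less_imp_neq)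
  have "b * (1 + q\<^sup>2) / (1 - q\<^sup>2) - b = 2 * b * q / (1 - q\<^sup>2) * q"
    using d by (simp add: field_simps power2_eq_square)
  then show ?thesis by (simp add: poisson_speed_def distrib_left)
qed

section \<open>Indistinguishable fields\<close>

theorem theorem3p6:
  fixes \<beta> p L\<beta> :: real and L :: "nat \<Rightarrow> real"
  assumes "\<beta> \<ge> 1"
    and "\<And>k. k \<le> smoothness_order \<beta> \<Longrightarrow> L k > 0"
    and "L\<beta> > 0"
    and "p \<ge> 1"
  shows "\<exists>C>0. \<forall>(x0 :: real^'n) \<in> cbox 0 1. \<forall>\<Delta>t>0. \<Delta>t \<le> inverse C \<longrightarrow>
    (\<exists>f0 \<in> smooth_class \<beta> L L\<beta>. \<exists>f1 \<in> smooth_class \<beta> L L\<beta>.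
       (\<forall>(i::int) x. ode_flow f0 x (of_int i * \<Delta>t) = ode_flow f1 x (of_int i * \<Delta>t)) \<and>
       C * norm (f0 x0 - f1 x0) \<ge> \<Delta>t powr \<beta> \<and>
       C * Lp_norm_on p (cbox 0 1) (\<lambda>x. norm (f0 x - f1 x)) \<ge> \<Delta>t powr \<beta>)"
proof -
  define l where "l = smoothness_order \<beta>"
  \<comment> \<open>For \<open>q \<le> 1 / 2\<close> the maximal speed is at most \<open>3 b\<close>.\<close>
  define b where "b = L 0 / 3"
  have b: "b > 0" using assms(2)[of 0] by (simp add: b_def)
  define K where "K = 2 * pi / b"
  have K: "K > 0" using b by (simp add: K_def)
  \<comment> \<open>The frequency is \<open>K / \<Delta>t\<close>. The constant \<open>c\<close> has to satisfy finitely many upper bounds, one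
    for each derivative and one for the Hoelder condition; the sum of their reciprocals, plus \<open>2\<close>
    to ensure \<open>q \<le> 1 / 2\<close>, takes care of all of them.\<close>
  define M where "M = (\<Sum>k\<le>l. 3 * b * K ^ k / L k) + 6 * b * K powr \<beta> / L\<beta>"
  have terms: "3 * b * K ^ k / L k \<ge> 0" if "k \<le> l" for k
    using that b K assms(2)[of k] by (simp add: l_def)
  have last: "6 * b * K powr \<beta> / L\<beta> \<ge> 0" using b assms(3) by simp
  have M: "M \<ge> 0"
    unfolding M_def using terms last by (intro add_nonneg_nonneg sum_nonneg) auto
  define c where "c = 1 / (2 + M)"
  have c: "c > 0" "c \<le> 1 / 2" using M by (auto simp: c_def field_simps)
  have c_le: "c * r \<le> 1" if "r \<le> M" for r using that M by (simp add: c_def pos_divide_le_eq)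
  have cL: "3 * b * c * K ^ k \<le> L k" if "k \<le> l" for k
  proof -
    have "3 * b * K ^ k / L k \<le> (\<Sum>k\<le>l. 3 * b * K ^ k / L k)"
      using that terms by (intro member_le_sum[of k "{..l}" "\<lambda>k. 3 * b * K ^ k / L k"]) auto
    then have "c * (3 * b * K ^ k / L k) \<le> 1" using last by (intro c_le) (simp add: M_def)
    then show ?thesis using assms(2)[of k] that by (simp add: l_def pos_divide_le_eq mult_ac)
  qed
  have cL\<beta>: "2 * (3 * b * c) * K powr \<beta> \<le> L\<beta>"
  proof -
    have "6 * b * K powr \<beta> / L\<beta> \<le> M" unfolding M_def
      using sum_nonneg[of "{..l}" "\<lambda>k. 3 * b * K ^ k / L k"] terms by simp
    from c_le[OF this] show ?thesis using assms(3) by (simp add: pos_divide_le_eq mult_ac)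
  qed
  \<comment> \<open>The first two summands give \<open>\<Delta>t \<le> 1\<close> and \<open>b \<Delta>t \<le> 1\<close>, the latter making the frequency at
    least \<open>6\<close>; the third one absorbs the factor \<open>1 / 128\<close> of the \<open>L^p\<close> bound.\<close>
  define C where "C = 1 + b + 64 / (b * c)"
  have C: "C \<ge> 1" "C \<ge> b" "C * (b * c) \<ge> 64"
    using b c by (auto simp: C_def distrib_right)
  obtain i :: 'n where "i \<in> UNIV" by blast
  have "\<exists>f0 \<in> smooth_class \<beta> L L\<beta>. \<exists>f1 \<in> smooth_class \<beta> L L\<beta>.
       (\<forall>(i::int) x. ode_flow f0 x (of_int i * \<Delta>t) = ode_flow f1 x (of_int i * \<Delta>t)) \<and>
       C * norm (f0 x0 - f1 x0) \<ge> \<Delta>t powr \<beta> \<and>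
       C * Lp_norm_on p (cbox 0 1) (\<lambda>x. norm (f0 x - f1 x)) \<ge> \<Delta>t powr \<beta>"
    if \<Delta>t: "\<Delta>t > 0" "\<Delta>t \<le> inverse C" for x0 :: "real^'n" and \<Delta>t
  proof -
    have "C * \<Delta>t \<le> 1" using \<Delta>t C by (simp add: field_simps)
    moreover have "1 * \<Delta>t \<le> C * \<Delta>t" "b * \<Delta>t \<le> C * \<Delta>t"
      using \<Delta>t C by (intro mult_right_mono; simp)+
    ultimately have small: "\<Delta>t \<le> 1" "b * \<Delta>t \<le> 1" by linarith+
    define \<omega> where "\<omega> = 2 * pi / (b * \<Delta>t)"
    have \<omega>K: "\<omega> = K / \<Delta>t" by (simp add: \<omega>_def K_def)
    have \<omega>6: "\<omega> \<ge> 6"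
    proof -
      have "6 * (b * \<Delta>t) \<le> 6 * 1" using small by (intro mult_left_mono) auto
      also have "\<dots> \<le> 2 * pi" using pi_gt3 by simp
      finally show ?thesis using b \<Delta>t by (simp add: \<omega>_def pos_le_divide_eq)
    qed
    define q where "q = c * \<Delta>t powr \<beta>"
    have "\<Delta>t powr \<beta> \<le> 1" using \<Delta>t small assms(1) by (intro powr_le1) auto
    then have "q \<le> c * 1" unfolding q_def using c by (intro mult_left_mono) auto
    moreover have "0 \<le> q" using c by (simp add: q_def)
    ultimately have q: "0 \<le> q" "q \<le> 1 / 2" "\<bar>q\<bar> < 1" using c by auto
    define B where "B = 2 * b * q / (1 - q\<^sup>2)"
    have B: "2 * b * q \<le> B" "B \<le> 3 * (b * q)" "B \<ge> 0"
    proof -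
      show B2: "2 * b * q \<le> B" and "B \<le> 3 * (b * q)"
        unfolding B_def using poisson_coefficient_bounds[OF b q(1,2)] by auto
      have "0 \<le> 2 * b * q" using b q by simp
      with B2 show "B \<ge> 0" by linarith
    qed
    have powers: "\<bar>B\<bar> * \<omega> ^ k \<le> L k" if "k \<le> l" for k
    proof -
      have "\<Delta>t powr \<beta> \<le> \<Delta>t powr real k"
        using \<Delta>t small that smoothness_order_bounds[OF assms(1)]
        by (intro powr_mono') (auto simp: l_def)
      then have ratio: "\<Delta>t powr \<beta> / \<Delta>t ^ k \<le> 1"
        using \<Delta>t by (simp add: powr_realpow)
      have "\<bar>B\<bar> * \<omega> ^ k \<le> 3 * (b * q) * \<omega> ^ k"
        using B \<omega>6 by (intro mult_right_mono) auto
      also have "\<dots> = 3 * b * c * K ^ k * (\<Delta>t powr \<beta> / \<Delta>t ^ k)"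
        by (simp add: q_def \<omega>K power_divide)
      also have "\<dots> \<le> 3 * b * c * K ^ k * 1"
        using ratio b c K by (intro mult_left_mono) auto
      also have "\<dots> \<le> L k" using cL[OF that] by simp
      finally show ?thesis .
    qed
    have top: "2 * \<bar>B\<bar> * \<omega> powr \<beta> \<le> L\<beta>"
    proof -
      have "2 * \<bar>B\<bar> * \<omega> powr \<beta> \<le> 2 * (3 * (b * q)) * \<omega> powr \<beta>"
        using B by (intro mult_right_mono) auto
      also have "\<dots> = 2 * (3 * b * c) * K powr \<beta>"
        using \<Delta>t K by (simp add: q_def \<omega>K powr_divide)
      also have "\<dots> \<le> L\<beta>" by (rule cL\<beta>)
      finally show ?thesis .
    qed
    define f where "f = (\<lambda>q' (x :: real^'n).
      poisson_speed b q' (\<omega> * (x $ i - x0 $ i)) *\<^sub>R axis i (1 :: real))"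
    have L_nonneg: "L k \<ge> 0" if "k \<le> smoothness_order \<beta>" for k
      using assms(2)[OF that] by simp
    have "f q \<in> smooth_class \<beta> L L\<beta>"
      unfolding f_def poisson_speed_def
      using poisson_coefficient_bounds(3)[OF b q(1,2)] powers top \<omega>6 assms(1) L_nonneg
      by (intro axis_wave_in_smooth_class) (auto simp: B_def l_def b_def)
    moreover have "f 0 \<in> smooth_class \<beta> L L\<beta>"
      unfolding f_def poisson_speed_def
      using \<omega>6 assms(1,3) L_nonneg
      by (intro axis_wave_in_smooth_class) (auto simp: b_def)
    moreover have "ode_flow (f 0) x (of_int k * \<Delta>t) = ode_flow (f q) x (of_int k * \<Delta>t)" for k :: int and x
      unfolding f_def \<omega>_def
      by (subst (1 2) ode_flow_poisson_stroboscopic[OF b _ \<Delta>t(1)]) (simp_all add: q(3))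
    moreover have diff: "norm (f 0 x - f q x) = \<bar>B * (q + cos (\<omega> * (x $ i - x0 $ i)))\<bar>" for x
      unfolding norm_minus_commute[of "f 0 x"]
      by (simp add: f_def B_def poisson_speed_deviation[OF q(3)] flip: scaleR_diff_left)
    moreover have large: "\<Delta>t powr \<beta> \<le> C * (B / 128)"
    proof -
      have "64 * \<Delta>t powr \<beta> \<le> C * (b * c) * \<Delta>t powr \<beta>"
        using C by (intro mult_right_mono) auto
      also have "\<dots> = C * (b * q)" by (simp add: q_def)
      also have "\<dots> \<le> C * (B / 2)" using B C by (intro mult_left_mono) auto
      finally show ?thesis by simp
    qed
    moreover have "C * (B / 128) \<le> C * norm (f 0 x0 - f q x0)"
    proof (rule mult_left_mono)
      have "B / 128 \<le> B * 1" using B by simp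
      also have "\<dots> \<le> B * (q + 1)" using B q by (intro mult_left_mono) auto
      also have "\<dots> = norm (f 0 x0 - f q x0)" using B q by (simp add: diff)
      finally show "B / 128 \<le> norm (f 0 x0 - f q x0)" .
    qed (use C in simp)
    moreover have "C * (B / 128) \<le> C * Lp_norm_on p (cbox 0 1) (\<lambda>x. norm (f 0 x - f q x))"
      unfolding diff using q \<omega>6 B C assms(4)
      by (intro mult_left_mono Lp_norm_shifted_cos_wave_ge) auto
    ultimately show ?thesis by (meson order_trans)
  qed
  moreover have "C > 0" using C by linarith
  ultimately show ?thesis by blast
qed

end
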